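(* For every rank-labeled binary tree $B$ on the node set $[T]$, the binary tree inequality induced by $B$, $$c \;\ge\; \sum_{t\in[T]} \delta^t\big(l(t),r(t)\big)\, v^t ,$$ induces a facet of the polyhedron $\operatorname{epi}(\mathrm{LCU}^\Sigma)\subseteq\mathbb{R}^{T}\times\mathbb{R}$ (points being written $(v,c)$).
   Context: Fix an integer $T\ge 1$, $[T]=\{1,\dots,T\}$ (periods), period lengths $L^1,\dots,L^T>0$, a pre-model offline time $\mathrm{PDT}\ge 0$, and a start-up cost function $\mathrm{CU}:[0,\infty)\to[0,\infty)$ that is (weakly) increasing, concave, and satisfies $\mathrm{CU}(0)=0$. For $t\in[T]$ and $l\in\{0,\dots,t-1\}$ let $\mathrm{OL}^t(l)=\sum_{j=1}^{l}L^{t-j}$ if $l<t-1$, and $\mathrm{OL}^t(l)=\sum_{j=1}^{l}L^{t-j}+\mathrm{PDT}$ if $l=t-1$; let $\mathrm{CU}^t(l)=\mathrm{CU}(\mathrm{OL}^t(l))$. For $v=(v^1,\dots,v^T)\in\{0,1\}^T$ let $\mathrm{ol}^t(v)=\max\{l\in\{0,\dots,t-1\}: v^{t-1}=\dots=v^{t-l}=0\}$, $\mathrm{DCU}^t(v)=\mathrm{CU}^t(\mathrm{ol}^t(v))$ if $v^t=1$ and $\mathrm{DCU}^t(v)=0$ otherwise, and $\mathrm{DCU}^\Sigma(v)=\sum_{t=1}^T\mathrm{DCU}^t(v)$. Let $\operatorname{epi}(\mathrm{DCU}^\Sigma)=\{(v,c): v\in\{0,1\}^T,\ c\ge \mathrm{DCU}^\Sigma(v)\}$,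 and let $\mathrm{LCU}^\Sigma:[0,1]^T\to\mathbb{R}$ be the unique function whose epigraph $\operatorname{epi}(\mathrm{LCU}^\Sigma)=\{(v,c):v\in[0,1]^T,\ c\ge\mathrm{LCU}^\Sigma(v)\}$ equals $\operatorname{conv}(\operatorname{epi}(\mathrm{DCU}^\Sigma))$. For $t\in[T]$ define $\delta^t:\{0,\dots,t-1\}\times\{0,\dots,T-t\}\to\mathbb{R}$ by $\delta^t(l,r)=\mathrm{CU}^t(l)+\mathrm{CU}^{t+r+1}(r)-\mathrm{CU}^{t+r+1}(l+r+1)$ if $t+r<T$, and $\delta^t(l,r)=\mathrm{CU}^t(l)$ if $t+r=T$. A binary tree is a rooted tree in which every node has at most one left child and at most one right child. It is a rank-labeled binary tree on $[T]$ if its node set is $[T]$ and the in-order (left-to-right) position of each node $t$ is $t$; i.e. all nodes in the left subtree of $t$ are smaller than $t$ and all nodes in the right subtree of $t$ are larger than $t$. $l(t)$ and $r(t)$ denote the numbers of nodes in the left and right subtree of $t$ (0 if empty). *)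

theory Defs
  imports "HOL-Analysis.Analysis" "HOL-Library.Tree"
begin

text \<open>Functions on the periods have type \<open>nat \<Rightarrow> _\<close> and are only relevant on \<open>{1..T}\<close>.\<close>

definition OL :: "(nat \<Rightarrow> real) \<Rightarrow> real \<Rightarrow> nat \<Rightarrow> nat \<Rightarrow> real" where
  "OL L PDT t l =
     (if l < t - 1 then \<Sum>j=1..l. L (t - j) else (\<Sum>j=1..l. L (t - j)) + PDT)"

definition CUt :: "(nat \<Rightarrow> real) \<Rightarrow> real \<Rightarrow> (real \<Rightarrow> real) \<Rightarrow> nat \<Rightarrow> nat \<Rightarrow> real" where
  "CUt L PDT CU t l = CU (OL L PDT t l)"

definition ol :: "nat \<Rightarrow> (nat \<Rightarrow> real) \<Rightarrow> nat" where
  "ol t v = Max {l \<in> {0..t - 1}. \<forall>j\<in>{1..l}. v (t - j) = 0}"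

definition DCU ::
  "(nat \<Rightarrow> real) \<Rightarrow> real \<Rightarrow> (real \<Rightarrow> real) \<Rightarrow> nat \<Rightarrow> (nat \<Rightarrow> real) \<Rightarrow> real" where
  "DCU L PDT CU t v = (if v t = 1 then CUt L PDT CU t (ol t v) else 0)"

definition DCU_sum ::
  "nat \<Rightarrow> (nat \<Rightarrow> real) \<Rightarrow> real \<Rightarrow> (real \<Rightarrow> real) \<Rightarrow> (nat \<Rightarrow> real) \<Rightarrow> real" where
  "DCU_sum T L PDT CU v = (\<Sum>t=1..T. DCU L PDT CU t v)"

definition \<delta> ::
  "nat \<Rightarrow> (nat \<Rightarrow> real) \<Rightarrow> real \<Rightarrow> (real \<Rightarrow> real) \<Rightarrow> nat \<Rightarrow> nat \<Rightarrow> nat \<Rightarrow> real" where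
  "\<delta> T L PDT CU t l r =
     (if t + r < T
      then CUt L PDT CU t l + CUt L PDT CU (t + r + 1) r - CUt L PDT CU (t + r + 1) (l + r + 1)
      else CUt L PDT CU t l)"

text \<open>
  The space \<open>real ^ 'n\<close> plays the role of \<open>\<real>\<^sup>T\<close>: a bijection \<open>e\<close> from \<open>{1..T}\<close> onto the index type
  names the coordinates, so that period \<open>t\<close> of \<open>v\<close> is \<open>v $ e t\<close>.
\<close>

definition binary_cube :: "(real ^ 'n) set" where
  "binary_cube = {v. \<forall>i. v $ i \<in> {0, 1}}"

definition unit_cube :: "(real ^ 'n) set" where
  "unit_cube = {v. \<forall>i. v $ i \<in> {0..1}}"

definition epi_DCU ::
  "nat \<Rightarrow> (nat \<Rightarrow> 'n) \<Rightarrow> (nat \<Rightarrow> real) \<Rightarrow> real \<Rightarrow> (real \<Rightarrow> real) \<Rightarrow> ((real ^ 'n::finite) \<times> real) set" where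
  "epi_DCU T e L PDT CU = epigraph binary_cube (\<lambda>v. DCU_sum T L PDT CU (\<lambda>t. v $ e t))"

text \<open>Extensionality only fixes the irrelevant values outside the unit cube.\<close>

definition LCU_sum ::
  "nat \<Rightarrow> (nat \<Rightarrow> 'n) \<Rightarrow> (nat \<Rightarrow> real) \<Rightarrow> real \<Rightarrow> (real \<Rightarrow> real) \<Rightarrow> (real ^ 'n::finite) \<Rightarrow> real" where
  "LCU_sum T e L PDT CU =
     (THE f. f \<in> extensional unit_cube \<and> epigraph unit_cube f = convex hull (epi_DCU T e L PDT CU))"

definition epi_LCU ::
  "nat \<Rightarrow> (nat \<Rightarrow> 'n) \<Rightarrow> (nat \<Rightarrow> real) \<Rightarrow> real \<Rightarrow> (real \<Rightarrow> real) \<Rightarrow> ((real ^ 'n::finite) \<times> real) set" where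
  "epi_LCU T e L PDT CU = epigraph unit_cube (LCU_sum T e L PDT CU)"

definition rank_labeled :: "nat \<Rightarrow> nat tree \<Rightarrow> bool" where
  "rank_labeled T B \<longleftrightarrow> inorder B = [1..<T + 1]"

text \<open>Numbers of nodes in the left and right subtree of the node labeled \<open>t\<close>
  (labels are assumed to be distinct).\<close>

fun left_size :: "'a tree \<Rightarrow> 'a \<Rightarrow> nat" where
  "left_size \<langle>\<rangle> t = 0"
| "left_size \<langle>l, x, r\<rangle> t =
     (if t = x then size l else if t \<in> set_tree l then left_size l t else left_size r t)"

fun right_size :: "'a tree \<Rightarrow> 'a \<Rightarrow> nat" where
  "right_size \<langle>\<rangle> t = 0"
| "right_size \<langle>l, x, r\<rangle> t =
     (if t = x then size r else if t \<in> set_tree l then right_size l t else right_size r t)"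

text \<open>
  An inequality \<open>c \<ge> a v\<close> induces a facet of \<open>P\<close> if it is valid for \<open>P\<close> and its points of equality
  in \<open>P\<close> form a facet.
\<close>

definition induces_facet :: "('a \<Rightarrow> real) \<Rightarrow> ('a::euclidean_space \<times> real) set \<Rightarrow> bool" where
  "induces_facet a P \<longleftrightarrow>
     (\<forall>(v, c) \<in> P. c \<ge> a v) \<and> {(v, c) \<in> P. c = a v} facet_of P"

text \<open>Well-definedness of \<^const>\<open>LCU_sum\<close>.\<close>

lemma epigraph_extensional_inject:
  assumes "f \<in> extensional C" "g \<in> extensional C" "epigraph C f = epigraph C g"
  shows "f = g"
proof (rule extensionalityI[OF assms(1,2)])
  fix x assume "x \<in> C"
  then have "(x, f x) \<in> epigraph C g" "(x, g x) \<in> epigraph C f"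
    using assms(3) mem_epigraph[of x "f x" C f] mem_epigraph[of x "g x" C g] by auto
  then show "f x = g x" by (auto simp: mem_epigraph intro: antisym)
qed

lemma ex_epigraph_convex_hull:
  fixes S :: "'a::euclidean_space set" and f :: "'a \<Rightarrow> real"
  assumes "finite S"
  shows "\<exists>g \<in> extensional (convex hull S).
           epigraph (convex hull S) g = convex hull (epigraph S f)"
proof -
  let ?E = "epigraph S f"
  define K where "K = convex hull ((\<lambda>x. (x, f x)) ` S)"
  define U where "U = {(x, c). \<exists>c'\<le>c. (x, c') \<in> K}"
  have "compact K"
    unfolding K_def using assms by (intro finite_imp_compact_convex_hull) auto
  have "convex K"
    unfolding K_def by simp
  have fstK: "fst ` K = convex hull S"
    unfolding K_def
    using convex_hull_linear_image[OF linear_fst, of "(\<lambda>x. (x, f x)) ` S"]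
    by (simp add: image_image)
  have "K \<subseteq> convex hull ?E"
    unfolding K_def by (rule hull_mono) (auto simp: mem_epigraph)
  have up: "(x, c) \<in> convex hull ?E" if "(x, c') \<in> convex hull ?E" "c' \<le> c" for x c c'
  proof -
    have "(\<lambda>p. (0, c - c') + p) ` (convex hull ?E) = convex hull ((\<lambda>p. (0, c - c') + p) ` ?E)"
      by (rule convex_hull_translation[symmetric])
    also have "\<dots> \<subseteq> convex hull ?E"
      using that(2) by (intro hull_mono) (auto simp: mem_epigraph)
    finally show ?thesis using that(1) by force
  qed
  have "convex U"
  proof (rule convexI)
    fix p q :: "'a \<times> real" and u v :: real
    assume pq: "p \<in> U" "q \<in> U" and uv: "0 \<le> u" "0 \<le> v" "u + v = 1"
    obtain x c c' y d d' where p: "p = (x, c)" "c' \<le> c" "(x, c') \<in> K"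
      and q: "q = (y, d)" "d' \<le> d" "(y, d') \<in> K"
      using pq by (auto simp: U_def)
    have "u *\<^sub>R (x, c') + v *\<^sub>R (y, d') \<in> K"
      using convexD[OF \<open>convex K\<close> p(3) q(3) uv] .
    moreover have "u * c' + v * d' \<le> u * c + v * d"
      using p q uv by (intro add_mono mult_left_mono) auto
    ultimately show "u *\<^sub>R p + v *\<^sub>R q \<in> U"
      by (auto simp: U_def p q)
  qed
  moreover have "?E \<subseteq> U"
    by (force simp: U_def K_def mem_epigraph intro: hull_inc)
  ultimately have "convex hull ?E \<subseteq> U"
    by (rule hull_minimal[rotated])
  moreover have "U \<subseteq> convex hull ?E"
    using \<open>K \<subseteq> convex hull ?E\<close> by (auto simp: U_def intro: up)
  ultimately have hullE: "convex hull ?E = U" by blast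
  have "\<exists>c. (x, c) \<in> K \<and> (\<forall>c'. (x, c') \<in> K \<longrightarrow> c \<le> c')" if "x \<in> convex hull S" for x
  proof -
    have "compact (K \<inter> ({x} \<times> UNIV))"
      using \<open>compact K\<close> by (intro compact_Int_closed closed_Times) auto
    then have "compact (snd ` (K \<inter> ({x} \<times> UNIV)))"
      by (intro compact_continuous_image continuous_intros)
    moreover have "snd ` (K \<inter> ({x} \<times> UNIV)) \<noteq> {}"
      using that fstK by force
    ultimately show ?thesis
      using compact_attains_inf[of "snd ` (K \<inter> ({x} \<times> UNIV))"] by force
  qed
  then obtain g where g: "\<And>x. x \<in> convex hull S \<Longrightarrow> (x, g x) \<in> K"
      "\<And>x c'. x \<in> convex hull S \<Longrightarrow> (x, c') \<in> K \<Longrightarrow> g x \<le> c'"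
    by metis
  have dom: "x \<in> convex hull S" if "(x, c) \<in> K" for x c
    using that fstK by force
  have "epigraph (convex hull S) (restrict g (convex hull S)) = U"
    using g dom by (fastforce simp: U_def epigraph_def intro: order_trans)
  then show ?thesis
    using hullE by (intro bexI[of _ "restrict g (convex hull S)"]) auto
qed

lemma convex_hull_binary_cube:
  "convex hull binary_cube = (unit_cube :: (real ^ 'n::finite) set)"
proof -
  have "(binary_cube :: (real ^ 'n) set) = {x. \<forall>i\<in>Basis. x \<bullet> i = 0 \<or> x \<bullet> i = 1}"
    by (auto simp: binary_cube_def Basis_vec_def inner_axis)
  moreover have "(unit_cube :: (real ^ 'n) set) = cbox 0 (\<Sum>Basis)"
  proof -
    have "(\<Sum>Basis :: real ^ 'n) \<bullet> b = 1" if "b \<in> Basis" for b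
      using that by simp
    then show ?thesis
      by (auto simp: unit_cube_def mem_box Basis_vec_def inner_axis)
  qed
  ultimately show ?thesis
    using unit_interval_convex_hull[where 'a = "real ^ 'n"] by simp
qed

lemma finite_binary_cube: "finite (binary_cube :: (real ^ 'n::finite) set)"
proof (rule finite_subset)
  show "(binary_cube :: (real ^ 'n) set) \<subseteq> (\<lambda>f. \<chi> i. f i) ` (UNIV \<rightarrow>\<^sub>E {0, 1})"
  proof
    fix v :: "real ^ 'n" assume "v \<in> binary_cube"
    then show "v \<in> (\<lambda>f. \<chi> i. f i) ` (UNIV \<rightarrow>\<^sub>E {0, 1})"
      by (intro image_eqI[of _ _ "\<lambda>i. v $ i"]) (auto simp: binary_cube_def)
  qed
qed (intro finite_imageI finite_PiE; simp)

lemma epi_LCU_eq: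
  "epi_LCU T e L PDT CU = convex hull (epi_DCU T e L PDT CU)"
proof -
  let ?P = "\<lambda>f. f \<in> extensional unit_cube \<and>
    epigraph unit_cube f = convex hull (epi_DCU T e L PDT CU)"
  have "\<exists>f. ?P f"
    using ex_epigraph_convex_hull[OF finite_binary_cube]
    unfolding convex_hull_binary_cube epi_DCU_def by blast
  then have "\<exists>!f. ?P f"
    using epigraph_extensional_inject by metis
  then have "?P (LCU_sum T e L PDT CU)"
    unfolding LCU_sum_def by (rule theI')
  then show ?thesis
    by (simp add: epi_LCU_def)
qed

end

theory Submission
  imports Defs
begin

text \<open>
  Let \<open>C i j\<close> be the cost of starting up in period \<open>j\<close> when the last operating period before it
  is \<open>i\<close>, where \<open>i = 0\<close> stands for the time before the model, and let \<open>C i (T + 1) = 0\<close>. The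
  start-up costs of a binary schedule are the cost of a chain from \<open>0\<close> to \<open>T + 1\<close> through its
  operating periods, and the coefficient of a tree node \<open>t\<close> whose subtree covers the periods
  strictly between \<open>i\<close> and \<open>j\<close> is the detour \<open>C i t + C t j - C i j\<close>. Concavity and monotonicity
  of \<open>CU\<close> make \<open>C\<close> a Monge array, so the detour via \<open>t\<close> gets cheaper when the endpoints move
  towards \<open>t\<close>. By induction on the tree this yields validity, and equality for a schedule
  whose restrictions to the two subtrees of an operating root are tight. Adding and removing tight
  schedules of the subtrees, all with the root switched on, produces every unit vector, so the
  tight points span the whole space.
\<close>

section \<open>Chains, trees and validity for a Monge array\<close>

fun chain_cost :: "('a \<Rightarrow> 'a \<Rightarrow> real) \<Rightarrow> 'a \<Rightarrow> 'a list \<Rightarrow> 'a \<Rightarrow> real" where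
  "chain_cost C i [] j = C i j"
| "chain_cost C i (x # xs) j = C i x + chain_cost C x xs j"

text \<open>The right-hand side of the tree inequality at the binary point with support
  \<open>A\<close>. Handing the enclosing periods \<open>i\<close> and \<open>j\<close> down the
  recursion, instead of reading subtree sizes off the whole tree, makes every subtree an instance of
  the same problem.\<close>

fun tree_value :: "('a \<Rightarrow> 'a \<Rightarrow> real) \<Rightarrow> 'a set \<Rightarrow> 'a \<Rightarrow> 'a \<Rightarrow> 'a tree \<Rightarrow> real" where
  "tree_value C A i j \<langle>\<rangle> = 0"
| "tree_value C A i j \<langle>l, t, r\<rangle> =
     (if t \<in> A then C i t + C t j - C i j else 0) + tree_value C A i t l + tree_value C A t j r"

lemma chain_cost_append:
  "chain_cost C i (xs @ t # ys) j = chain_cost C i xs t + chain_cost C t ys j"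
  by (induction xs arbitrary: i) auto

text \<open>Inserting \<open>t\<close> into a finer chain costs at most the detour via
  \<open>t\<close> on the direct arc from \<open>i\<close> to \<open>j\<close>. The induction moves
  the left endpoint along \<open>xs\<close>; each move is one Monge exchange.\<close>

lemma chain_cost_skip:
  fixes C :: "'a::linorder \<Rightarrow> 'a \<Rightarrow> real"
  assumes monge: "\<And>i p t q. i \<le> p \<Longrightarrow> p < t \<Longrightarrow> t \<le> q \<Longrightarrow> q \<le> N \<Longrightarrow> C i q + C p t \<le> C p q + C i t"
    and "sorted_wrt (<) (i # xs @ t # ys @ [j])" "j \<le> N"
  shows "chain_cost C i xs t + chain_cost C t ys j - C i t - C t j + C i j
    \<le> chain_cost C i (xs @ ys) j"
  using assms(2)
proof (induction xs arbitrary: i)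
  case Nil
  then show ?case
    \<comment> \<open>Only the first arc of the chain through \<open>ys\<close> depends on where the
      chain starts, so one exchange between the starts \<open>i\<close> and \<open>t\<close>
      suffices.\<close>
    using monge[of i t _ j] \<open>j \<le> N\<close> by (cases ys) force+
next
  case (Cons x xs)
  have "C i j + C x t \<le> C x j + C i t"
    using Cons.prems \<open>j \<le> N\<close> by (intro monge) (auto simp: sorted_wrt_append)
  then show ?case
    using Cons.IH[of x] Cons.prems by auto
qed

text \<open>If the root operates, the chain splits there and the two inductive bounds add up.
  Otherwise they bound a chain forced through the root, and \<open>chain_cost_skip\<close> removes
  the root from it.\<close>

lemma tree_value_le_chain_cost:
  fixes C :: "'a::linorder \<Rightarrow> 'a \<Rightarrow> real"
  assumes monge: "\<And>i p t q. i \<le> p \<Longrightarrow> p < t \<Longrightarrow> t \<le> q \<Longrightarrow> q \<le> N \<Longrightarrow> C i q + C p t \<le> C p q + C i t"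
    and "sorted_wrt (<) (i # inorder B @ [j])" "j \<le> N"
  shows "tree_value C A i j B \<le> chain_cost C i (filter (\<lambda>t. t \<in> A) (inorder B)) j - C i j"
  using assms(2,3)
proof (induction B arbitrary: i j)
  case Leaf
  then show ?case by simp
next
  case (Node l t r)
  let ?xs = "filter (\<lambda>t. t \<in> A) (inorder l)" and ?ys = "filter (\<lambda>t. t \<in> A) (inorder r)"
  have l: "tree_value C A i t l \<le> chain_cost C i ?xs t - C i t"
    using Node.prems by (intro Node.IH) (auto simp: sorted_wrt_append)
  have r: "tree_value C A t j r \<le> chain_cost C t ?ys j - C t j"
    using Node.prems by (intro Node.IH) (auto simp: sorted_wrt_append)
  show ?case
  proof (cases "t \<in> A")
    case True
    then show ?thesis using l r by (simp add: chain_cost_append)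
  next
    case False
    have "chain_cost C i ?xs t + chain_cost C t ?ys j - C i t - C t j + C i j
      \<le> chain_cost C i (?xs @ ?ys) j"
      using Node.prems
      by (intro chain_cost_skip[OF monge]) (auto simp: sorted_wrt_append sorted_wrt_filter)
    then show ?thesis using False l r by simp
  qed
qed

section \<open>Tight schedules and their span\<close>

definition tight_sets :: "('a \<Rightarrow> 'a \<Rightarrow> real) \<Rightarrow> 'a \<Rightarrow> 'a \<Rightarrow> 'a tree \<Rightarrow> 'a set set" where
  "tight_sets C i j B = {A. A \<subseteq> set_tree B \<and>
     tree_value C A i j B = chain_cost C i (filter (\<lambda>t. t \<in> A) (inorder B)) j - C i j}"

lemma tight_sets_subset: "A \<in> tight_sets C i j B \<Longrightarrow> A \<subseteq> set_tree B"
  by (simp add: tight_sets_def)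

lemma tree_value_cong:
  "(\<And>x. x \<in> set_tree B \<Longrightarrow> x \<in> A \<longleftrightarrow> x \<in> A') \<Longrightarrow>
    tree_value C A i j B = tree_value C A' i j B"
  by (induction B arbitrary: i j) simp_all

lemma tree_value_empty: "tree_value C {} i j B = 0"
  by (induction B arbitrary: i j) auto

lemma empty_in_tight_sets: "{} \<in> tight_sets C i j B"
  by (simp add: tight_sets_def tree_value_empty)

text \<open>With an operating root the chain splits at \<open>t\<close>, and the terms
  \<open>C i t\<close> and \<open>C t j\<close> of the detour cancel against those of the two
  equalities. Sortedness makes the labels distinct, so within each subtree the union reduces to
  \<open>X\<close> or \<open>Y\<close>.\<close>

lemma tight_sets_NodeI:
  fixes C :: "'a::linorder \<Rightarrow> 'a \<Rightarrow> real"
  assumes "sorted_wrt (<) (inorder \<langle>l, t, r\<rangle>)"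
    and X: "X \<in> tight_sets C i t l" and Y: "Y \<in> tight_sets C t j r"
  shows "insert t (X \<union> Y) \<in> tight_sets C i j \<langle>l, t, r\<rangle>"
proof -
  let ?A = "insert t (X \<union> Y)"
  have sub: "X \<subseteq> set_tree l" "Y \<subseteq> set_tree r"
    using X Y by (auto dest: tight_sets_subset)
  have lt: "\<forall>x\<in>set_tree l. x < t" and gt: "\<forall>y\<in>set_tree r. t < y"
    using assms(1) by (auto simp: sorted_wrt_append)
  have l: "x \<in> ?A \<longleftrightarrow> x \<in> X" if "x \<in> set_tree l" for x
  proof -
    have "x < t" using that lt by blast
    then show ?thesis using gt sub(2) by force
  qed
  have r: "x \<in> ?A \<longleftrightarrow> x \<in> Y" if "x \<in> set_tree r" for x
  proof -
    have "t < x" using that gt by blast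
    then show ?thesis using lt sub(1) by force
  qed
  have "tree_value C ?A i t l = tree_value C X i t l" "tree_value C ?A t j r = tree_value C Y t j r"
    by (rule tree_value_cong, rule l, assumption, rule tree_value_cong, rule r)
  moreover have "filter (\<lambda>x. x \<in> ?A) (inorder l) = filter (\<lambda>x. x \<in> X) (inorder l)"
    "filter (\<lambda>x. x \<in> ?A) (inorder r) = filter (\<lambda>x. x \<in> Y) (inorder r)"
    by (rule filter_cong[OF refl], rule l, simp, rule filter_cong[OF refl], rule r, simp)
  moreover have "?A \<subseteq> set_tree \<langle>l, t, r\<rangle>"
    using sub by auto
  ultimately show ?thesis
    using X Y by (simp add: tight_sets_def chain_cost_append)
qed

text \<open>The endpoints stay arbitrary because the root becomes an endpoint of both subtrees. In
  the application \<open>f\<close> yields the unit vectors, so \<open>sum f\<close> yields incidence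
  vectors.\<close>

lemma span_tight_sets:
  fixes C :: "'a::linorder \<Rightarrow> 'a \<Rightarrow> real" and f :: "'a \<Rightarrow> 'b::real_vector"
  assumes "sorted_wrt (<) (inorder B)" "x \<in> set_tree B"
  shows "f x \<in> span (sum f ` tight_sets C i j B)"
  using assms
proof (induction B arbitrary: i j)
  case Leaf
  then show ?case by simp
next
  case (Node l t r)
  let ?S = "span (sum f ` tight_sets C i j \<langle>l, t, r\<rangle>)"
  have lt: "\<forall>x\<in>set_tree l. x < t" and gt: "\<forall>y\<in>set_tree r. t < y"
    and sorted: "sorted_wrt (<) (inorder l)" "sorted_wrt (<) (inorder r)"
    using Node.prems by (auto simp: sorted_wrt_append)
  have base: "sum f (insert t (X \<union> Y)) \<in> ?S"
    if "X \<in> tight_sets C i t l" "Y \<in> tight_sets C t j r" for X Y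
    using tight_sets_NodeI[OF Node.prems(1) that] by (intro span_base imageI)
  \<comment> \<open>Both subtrees idle is a tight choice, so the root alone is tight.\<close>
  have root: "f t \<in> ?S"
    using base[OF empty_in_tight_sets empty_in_tight_sets] by simp
  have shift: "sum f X \<in> ?S"
    if "sum f (insert t X) \<in> ?S" "X \<subseteq> set_tree l \<union> set_tree r" for X
  proof -
    have "finite X"
      using that(2) by (rule finite_subset) simp
    moreover have "t \<notin> X"
      using that(2) lt gt by blast
    ultimately show ?thesis
      using span_diff[OF that(1) root] by simp
  qed
  have "sum f X \<in> ?S" if "X \<in> tight_sets C i t l" for X
    using base[OF that empty_in_tight_sets] tight_sets_subset[OF that] shift[of X] by auto
  then have left: "span (sum f ` tight_sets C i t l) \<subseteq> ?S"
    by (intro span_minimal) auto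
  have "sum f X \<in> ?S" if "X \<in> tight_sets C t j r" for X
    using base[OF empty_in_tight_sets that] tight_sets_subset[OF that] shift[of X] by auto
  then have right: "span (sum f ` tight_sets C t j r) \<subseteq> ?S"
    by (intro span_minimal) auto
  from Node.prems(2) consider "x = t" | "x \<in> set_tree l" | "x \<in> set_tree r"
    by auto
  then show ?case
  proof cases
    case 1
    then show ?thesis using root by blast
  next
    case 2
    then show ?thesis using Node.IH(1)[OF sorted(1)] left by blast
  next
    case 3
    then show ?thesis using Node.IH(2)[OF sorted(2)] right by blast
  qed
qed

section \<open>Subtree sizes in trees that list an interval\<close>

lemma upt_eq_append_Cons_iff:
  "[i..<j] = xs @ t # ys \<longleftrightarrow> i \<le> t \<and> t < j \<and> xs = [i..<t] \<and> ys = [Suc t..<j]"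
proof -
  have split: "[i..<j] = [i..<t] @ t # [Suc t..<j]" if "i \<le> t" "t < j"
    using that upt_add_eq_append[of i t "j - t"] by (simp add: upt_conv_Cons)
  have "i \<le> t \<and> t < j \<and> length xs = t - i" if eq: "[i..<j] = xs @ t # ys"
  proof -
    have "j - i = length xs + Suc (length ys)"
      using arg_cong[OF eq, of length] by simp
    moreover have "[i..<j] ! length xs = t"
      by (simp add: eq)
    ultimately show ?thesis by auto
  qed
  note bounds = this
  show ?thesis
  proof
    assume eq: "[i..<j] = xs @ t # ys"
    with bounds[OF eq] split have "xs @ t # ys = [i..<t] @ t # [Suc t..<j]"
      by simp
    with bounds[OF eq] show "i \<le> t \<and> t < j \<and> xs = [i..<t] \<and> ys = [Suc t..<j]"
      by (simp add: append_eq_append_conv)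
  qed (use split in simp)
qed

text \<open>Keeps the natural subtraction \<open>t - left_size B t - 1\<close> from being truncated.
  The listed interval starts at \<open>Suc i\<close>, so 0 is never a label.\<close>

lemma left_size_less:
  assumes "inorder B = [Suc i..<j]" "t \<in> set_tree B"
  shows "left_size B t < t"
  using assms
proof (induction B arbitrary: i j)
  case Leaf
  then show ?case by simp
next
  case (Node l x r)
  have l: "inorder l = [Suc i..<x]" and r: "inorder r = [Suc x..<j]" and "i < x"
    using upt_eq_append_Cons_iff[of "Suc i" j "inorder l" x "inorder r"] Node.prems(1) by auto
  moreover have "size l = x - i - 1"
    using arg_cong[OF l, of length] by simp
  ultimately show ?case
    using Node.IH(1)[OF l] Node.IH(2)[OF r] Node.prems(2) by auto
qed

text \<open>The subtree of \<open>t\<close> covers an interval around \<open>t\<close>, so its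
  enclosing periods can be recovered from the two subtree sizes. This links the size-based
  coefficients to the recursion.\<close>

lemma tree_value_eq_sum_sizes:
  assumes "inorder B = [Suc i..<j]"
    and "\<And>t. t \<in> set_tree B \<Longrightarrow> v t = of_bool (t \<in> A)"
  shows "(\<Sum>t\<in>set_tree B.
      (C (t - left_size B t - 1) t + C t (t + right_size B t + 1)
       - C (t - left_size B t - 1) (t + right_size B t + 1)) * v t) = tree_value C A i j B"
  using assms
proof (induction B arbitrary: i j)
  case Leaf
  then show ?case by simp
next
  case (Node l t r)
  let ?B = "\<langle>l, t, r\<rangle>"
  let ?f = "\<lambda>B t. (C (t - left_size B t - 1) t + C t (t + right_size B t + 1)
       - C (t - left_size B t - 1) (t + right_size B t + 1)) * v t"
  have t: "i < t" "t < j" and l: "inorder l = [Suc i..<t]" and r: "inorder r = [Suc t..<j]"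
    using upt_eq_append_Cons_iff[of "Suc i" j "inorder l" t "inorder r"] Node.prems(1) by auto
  have sets: "set_tree l = {i<..<t}" "set_tree r = {t<..<j}"
    using arg_cong[OF l, of set] arg_cong[OF r, of set] by auto
  have sizes: "size l = t - i - 1" "size r = j - t - 1"
    using arg_cong[OF l, of length] arg_cong[OF r, of length] by auto
  have root: "?f ?B t = (if t \<in> A then C i t + C t j - C i j else 0)"
    using t sizes Node.prems(2)[of t] by simp
  have "sum (?f ?B) (set_tree l) = sum (?f l) (set_tree l)"
    by (rule sum.cong) (auto simp: sets)
  also have "\<dots> = tree_value C A i t l"
    using l Node.prems by (intro Node.IH) auto
  finally have left: "sum (?f ?B) (set_tree l) = tree_value C A i t l" .
  have "sum (?f ?B) (set_tree r) = sum (?f r) (set_tree r)"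
    by (rule sum.cong) (auto simp: sets)
  also have "\<dots> = tree_value C A t j r"
    using r Node.prems by (intro Node.IH) auto
  finally have right: "sum (?f ?B) (set_tree r) = tree_value C A t j r" .
  have "sum (?f ?B) (set_tree ?B)
      = ?f ?B t + (sum (?f ?B) (set_tree l) + sum (?f ?B) (set_tree r))"
    using sets by (subst sum.union_disjoint[symmetric]) auto
  then show ?case
    using root left right by simp
qed

section \<open>Start-up costs as a Monge array\<close>

definition startup_cost ::
  "nat \<Rightarrow> (nat \<Rightarrow> real) \<Rightarrow> real \<Rightarrow> (real \<Rightarrow> real) \<Rightarrow> nat \<Rightarrow> nat \<Rightarrow> real" where
  "startup_cost T L PDT CU i j =
     (if j \<le> T then CU ((\<Sum>k\<in>{i<..<j}. L k) + (if i = 0 then PDT else 0)) else 0)"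

text \<open>After \<open>l\<close> idle periods the last operating period is
  \<open>t - l - 1\<close>; it is 0 exactly in the case \<open>l = t - 1\<close>, where
  \<open>OL\<close> adds \<open>PDT\<close>.\<close>

lemma CUt_eq_startup_cost:
  assumes "l < t" "t \<le> T"
  shows "CUt L PDT CU t l = startup_cost T L PDT CU (t - l - 1) t"
proof -
  have "(\<Sum>j=1..l. L (t - j)) = (\<Sum>k\<in>{t - l - 1<..<t}. L k)"
    by (rule sum.reindex_bij_witness[of _ "\<lambda>k. t - k" "\<lambda>j. t - j"]) (use assms in auto)
  then show ?thesis
    using assms by (auto simp: CUt_def OL_def startup_cost_def)
qed

text \<open>The case distinction in \<open>\<delta>\<close> disappears because arcs ending beyond
  \<open>T\<close> cost 0.\<close>

lemma \<delta>_eq_startup_cost: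
  assumes "l < t" "t \<le> T"
  shows "\<delta> T L PDT CU t l r =
    startup_cost T L PDT CU (t - l - 1) t + startup_cost T L PDT CU t (t + r + 1)
    - startup_cost T L PDT CU (t - l - 1) (t + r + 1)"
proof (cases "t + r < T")
  case True
  have "t + r + 1 - r - 1 = t" "t + r + 1 - (l + r + 1) - 1 = t - l - 1"
    using assms by auto
  then show ?thesis
    using True assms CUt_eq_startup_cost[of l t T L PDT CU]
      CUt_eq_startup_cost[of r "t + r + 1" T L PDT CU]
      CUt_eq_startup_cost[of "l + r + 1" "t + r + 1" T L PDT CU]
    by (simp add: \<delta>_def)
next
  case False
  then show ?thesis
    using assms CUt_eq_startup_cost[of l t T L PDT CU]
    by (simp add: \<delta>_def) (simp add: startup_cost_def)
qed

text \<open>The points \<open>x + g\<close> and \<open>x + h\<close> are convex combinations of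
  \<open>x\<close> and \<open>x + g + h\<close> with complementary weights, so the two concavity
  inequalities add up to the claim.\<close>

lemma concave_on_increments:
  fixes f :: "real \<Rightarrow> real"
  assumes "concave_on {0..} f" "0 \<le> x" "0 \<le> g" "0 \<le> h"
  shows "f (x + g + h) + f x \<le> f (x + g) + f (x + h)"
proof (cases "g + h = 0")
  case True
  then have "g = 0" "h = 0" using assms by auto
  then show ?thesis by simp
next
  case False
  define w where "w = g / (g + h)"
  have w: "0 \<le> w" "w \<le> 1"
    using assms False by (auto simp: w_def)
  have conc: "(1 - u) * f x + u * f (x + g + h) \<le> f ((1 - u) * x + u * (x + g + h))"
    if "0 \<le> u" "u \<le> 1" for u
    using concave_onD[OF assms(1) that, of x "x + g + h"] assms by auto
  have wg: "w * (g + h) = g"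
    using False by (simp add: w_def)
  have "(1 - w) * x + w * (x + g + h) = x + w * (g + h)"
    "(1 - (1 - w)) * x + (1 - w) * (x + g + h) = x + (g + h) - w * (g + h)"
    by (simp_all add: algebra_simps)
  then have "(1 - w) * f x + w * f (x + g + h) \<le> f (x + g)"
    "w * f x + (1 - w) * f (x + g + h) \<le> f (x + h)"
    using conc[of w] conc[of "1 - w"] w unfolding wg by (simp_all add: algebra_simps)
  then show ?thesis
    by (simp add: algebra_simps)
qed

text \<open>For \<open>q \<le> T\<close> this is concavity at the offline time between
  \<open>p\<close> and \<open>t\<close>, with the time gained on the left and on the right as
  increments. For \<open>q = Suc T\<close> the arcs into \<open>q\<close> vanish and monotonicity
  remains.\<close>

lemma startup_cost_monge:
  assumes L: "\<And>t. t \<in> {1..T} \<Longrightarrow> L t > 0" and "PDT \<ge> 0"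
    and mono: "mono_on {0..} CU" and "concave_on {0..} CU"
    and "i \<le> p" "p < t" "t \<le> q" "q \<le> Suc T"
  shows "startup_cost T L PDT CU i q + startup_cost T L PDT CU p t
    \<le> startup_cost T L PDT CU p q + startup_cost T L PDT CU i t"
proof (cases "i = p \<or> t = q")
  case True
  then show ?thesis by auto
next
  case False
  then have ip: "i < p" and tq: "t < q"
    using assms by auto
  define D where "D i j = sum L {i<..<j} + (if i = 0 then PDT else 0)" for i j
  define g where "g = sum L {i<..p} + (if i = 0 then PDT else 0)"
  have L_nonneg: "sum L A \<ge> 0" if "A \<subseteq> {1..T}" for A
    using less_imp_le[OF L] that by (intro sum_nonneg) blast
  have "{i<..p} \<subseteq> {1..T}" "{p<..<t} \<subseteq> {1..T}"
    using assms by auto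
  then have g: "g \<ge> 0" and D: "D p t \<ge> 0"
    using L_nonneg \<open>PDT \<ge> 0\<close> by (simp_all add: g_def D_def)
  \<comment> \<open>As \<open>i < p\<close>, period \<open>p\<close> is not 0, so \<open>PDT\<close>
    can occur only in \<open>D i s\<close>, where \<open>g\<close> accounts for it.\<close>
  have shift: "D i s = D p s + g" if "p < s" for s
  proof -
    have "{i<..<s} = {i<..p} \<union> {p<..<s}"
      using ip that by auto
    moreover have "{i<..p} \<inter> {p<..<s} = {}"
      by auto
    ultimately show ?thesis
      using ip by (simp add: D_def g_def sum.union_disjoint)
  qed
  have C: "startup_cost T L PDT CU a b = (if b \<le> T then CU (D a b) else 0)" for a b
    by (simp add: startup_cost_def D_def)
  show ?thesis
  proof (cases "q \<le> T")
    case True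
    define h where "h = sum L {t..<q}"
    have "{p<..<q} = {p<..<t} \<union> {t..<q}" "{p<..<t} \<inter> {t..<q} = {}"
      using assms tq by auto
    then have h: "D p q = D p t + h"
      by (simp add: D_def h_def sum.union_disjoint)
    have "{t..<q} \<subseteq> {1..T}"
      using assms True by auto
    then have "h \<ge> 0"
      using L_nonneg by (simp add: h_def)
    from concave_on_increments[OF \<open>concave_on {0..} CU\<close> D g this] show ?thesis
      using True tq assms shift[of t] shift[of q] h
      by (simp add: C) (simp add: algebra_simps)
  next
    case False
    have "CU (D p t) \<le> CU (D p t + g)"
      using mono D g by (intro mono_onD[OF mono]) auto
    then show ?thesis
      using False tq assms shift[of t] by (simp add: C)
  qed
qed

section \<open>Costs of binary schedules as chain costs\<close>

lemma ol_le: "ol t v \<le> t - 1"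
proof -
  let ?M = "{l \<in> {0..t - 1}. \<forall>j\<in>{1..l}. v (t - j) = 0}"
  have "0 \<in> ?M"
    by simp
  moreover have "finite ?M"
    by simp
  ultimately have "Max ?M \<in> ?M"
    using Max_in by blast
  then have "Max ?M \<le> t - 1"
    unfolding mem_Collect_eq atLeastAtMost_iff by blast
  then show ?thesis
    unfolding ol_def .
qed

lemma ol_1: "ol (Suc 0) v = 0"
  using ol_le[of "Suc 0" v] by simp

text \<open>If period \<open>t\<close> is off, the admissible run lengths at \<open>Suc t\<close>
  are 0 and the successors of those at \<open>t\<close>. For \<open>t \<ge> 1\<close> the bound
  \<open>t - 1\<close> grows by one too, which truncated subtraction would spoil at 0.\<close>

lemma ol_Suc:
  assumes "t \<ge> 1"
  shows "ol (Suc t) v = (if v t = 0 then Suc (ol t v) else 0)"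
proof (cases "v t = 0")
  case True
  let ?M = "{l \<in> {0..t - 1}. \<forall>j\<in>{1..l}. v (t - j) = 0}"
  have shift: "(\<forall>j\<in>{1..Suc l}. v (Suc t - j) = 0) \<longleftrightarrow> (\<forall>j\<in>{1..l}. v (t - j) = 0)" for l
  proof -
    have eq: "{1..Suc l} = insert 1 (Suc ` {1..l})"
      by (simp add: atLeastAtMost_insertL)
    show ?thesis
      unfolding eq ball_simps using True by simp
  qed
  have "{l \<in> {0..Suc t - 1}. \<forall>j\<in>{1..l}. v (Suc t - j) = 0} = insert 0 (Suc ` ?M)"
  proof (rule set_eqI)
    fix l
    show "l \<in> {l \<in> {0..Suc t - 1}. \<forall>j\<in>{1..l}. v (Suc t - j) = 0} \<longleftrightarrow> l \<in> insert 0 (Suc ` ?M)"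
    proof (cases l)
      case (Suc k)
      have "Suc k \<in> Suc ` ?M \<longleftrightarrow> k \<in> ?M"
        by (rule inj_image_mem_iff) simp
      then show ?thesis
        using shift[of k] assms unfolding Suc by (simp del: ball_simps) linarith
    qed simp
  qed
  then have "ol (Suc t) v = Max (insert 0 (Suc ` ?M))"
    unfolding ol_def by simp
  also have "\<dots> = max 0 (Max (Suc ` ?M))"
    by (intro Max_insert) auto
  also have "Max (Suc ` ?M) = Suc (Max ?M)"
    by (intro mono_Max_commute[symmetric]) (auto intro: monoI)
  finally show ?thesis
    using True by (simp add: ol_def)
next
  case False
  then have eq: "{l \<in> {0..Suc t - 1}. \<forall>j\<in>{1..l}. v (Suc t - j) = 0} = {0}"
    by force
  show ?thesis
    using False unfolding ol_def eq by simp
qed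

text \<open>\<open>n - ol (Suc n) v\<close> is the last operating period up to \<open>n\<close>, or
  0 if there is none. The final arc leaves from there to a free endpoint \<open>j\<close>; taking
  \<open>j = Suc n\<close> turns it into the start-up cost of the next period.\<close>

lemma chain_cost_upt_eq_sum_DCU:
  assumes "n \<le> T" "\<And>t. t \<in> {1..n} \<Longrightarrow> v t = of_bool (t \<in> A)"
  shows "chain_cost (startup_cost T L PDT CU) 0 (filter (\<lambda>t. t \<in> A) [1..<n + 1]) j =
    (\<Sum>t=1..n. DCU L PDT CU t v) + startup_cost T L PDT CU (n - ol (Suc n) v) j"
  using assms
proof (induction n arbitrary: j)
  case 0
  then show ?case by (simp add: ol_1)
next
  case (Suc n)
  have v: "v (Suc n) = of_bool (Suc n \<in> A)"
    using Suc.prems by simp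
  have ol: "ol (Suc n) v < Suc n"
    using ol_le[of "Suc n" v] by simp
  have IH: "chain_cost (startup_cost T L PDT CU) 0 (filter (\<lambda>t. t \<in> A) [1..<n + 1]) j =
    (\<Sum>t=1..n. DCU L PDT CU t v) + startup_cost T L PDT CU (n - ol (Suc n) v) j" for j
    using Suc by auto
  show ?case
  proof (cases "Suc n \<in> A")
    case True
    have "DCU L PDT CU (Suc n) v = startup_cost T L PDT CU (n - ol (Suc n) v) (Suc n)"
      using True v CUt_eq_startup_cost[OF ol Suc.prems(1)] by (simp add: DCU_def)
    then show ?thesis
      using True v IH[of "Suc n"] by (simp add: chain_cost_append ol_Suc)
  next
    case False
    then show ?thesis
      using v IH[of j] by (simp add: ol_Suc DCU_def)
  qed
qed

lemma DCU_sum_eq_chain_cost: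
  assumes "\<And>t. t \<in> {1..T} \<Longrightarrow> v t = of_bool (t \<in> A)"
  shows "DCU_sum T L PDT CU v =
    chain_cost (startup_cost T L PDT CU) 0 (filter (\<lambda>t. t \<in> A) [1..<T + 1]) (Suc T)"
  using chain_cost_upt_eq_sum_DCU[of T T v A L PDT CU "Suc T"] assms
  by (simp add: DCU_sum_def) (simp add: startup_cost_def)

section \<open>Facet criterion\<close>

text \<open>The equality set is a proper face, hence of dimension at most \<open>DIM('a)\<close>. It
  contains the origin and its projection to \<open>v\<close> spans the space, hence its dimension is
  at least \<open>DIM('a)\<close>.\<close>

lemma induces_facetI:
  fixes P :: "('a::euclidean_space \<times> real) set"
  assumes a: "linear a" and "convex P"
    and valid: "\<And>v c. (v, c) \<in> P \<Longrightarrow> a v \<le> c"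
    and zero: "(0, 0) \<in> P" and above: "(u, c) \<in> P" "c \<noteq> a u"
    and span: "\<And>x. x \<in> span {v. (v, a v) \<in> P}"
  shows "induces_facet a P"
proof -
  \<comment> \<open>\<open>adjoint a 1\<close> is the vector representing the functional
    \<open>a\<close>.\<close>
  define n where "n = (- adjoint a 1, 1 :: real)"
  have n: "n \<bullet> (v, c) = c - a v" for v c
    using adjoint_works[OF a, of v 1] by (simp add: n_def inner_commute)
  let ?F = "{(v, c) \<in> P. c = a v}"
  have "P \<inter> {x. n \<bullet> x = 0} face_of P"
    using valid by (intro face_of_Int_supporting_hyperplane_ge \<open>convex P\<close>) (auto simp: n)
  moreover have "P \<inter> {x. n \<bullet> x = 0} = ?F"
    by (auto simp: n)
  ultimately have face: "?F face_of P"
    by simp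
  have "(0, 0) \<in> ?F"
    using zero linear_0[OF a] by simp
  then have 0: "0 \<in> ?F"
    by (simp only: zero_prod_def)
  have "?F \<noteq> P"
    using above by auto
  then have less: "aff_dim ?F < aff_dim P"
    using face \<open>convex P\<close> by (intro face_of_aff_dim_lt)
  have "aff_dim P \<le> int DIM('a) + 1"
    using aff_dim_le_DIM[of P] by simp
  moreover have "int DIM('a) \<le> aff_dim ?F"
  proof -
    have "fst ` ?F = {v. (v, a v) \<in> P}"
      by (auto simp: image_iff)
    moreover have "span {v. (v, a v) \<in> P} = UNIV"
      using span by (rule UNIV_eq_I[symmetric])
    ultimately have "DIM('a) = dim (span (fst ` ?F))"
      by (simp only: dim_UNIV)
    also have "\<dots> = dim (fst ` ?F)"
      by (rule dim_span)
    also have "\<dots> \<le> dim ?F"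
      by (intro dim_image_le linear_fst)
    also have "int \<dots> = aff_dim ?F"
      using aff_dim_zero[OF hull_inc[OF 0]] by simp
    finally show ?thesis by simp
  qed
  ultimately have "?F facet_of P"
    using face 0 less by (auto simp: facet_of_def)
  then show ?thesis
    using valid by (auto simp: induces_facet_def)
qed

section \<open>The tree inequality on the epigraph\<close>

theorem theorem5p6:
  fixes T :: nat and e :: "nat \<Rightarrow> 'n::finite"
    and L :: "nat \<Rightarrow> real" and PDT :: real and CU :: "real \<Rightarrow> real"
    and B :: "nat tree"
  assumes "T \<ge> 1"
    and "bij_betw e {1..T} UNIV"
    and "\<And>t. t \<in> {1..T} \<Longrightarrow> L t > 0"
    and "PDT \<ge> 0"
    and "\<And>x. x \<ge> 0 \<Longrightarrow> CU x \<ge> 0"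
    and "mono_on {0..} CU"
    and "concave_on {0..} CU"
    and "CU 0 = 0"
    and "rank_labeled T B"
  shows "induces_facet
           (\<lambda>v::real ^ 'n. \<Sum>t\<in>{1..T}. \<delta> T L PDT CU t (left_size B t) (right_size B t) * v $ e t)
           (epi_LCU T e L PDT CU)"
proof -
  let ?C = "startup_cost T L PDT CU"
  let ?P = "epi_LCU T e L PDT CU"
  define a where "a v = (\<Sum>t\<in>{1..T}. \<delta> T L PDT CU t (left_size B t) (right_size B t) * v $ e t)"
    for v :: "real ^ 'n"
  have B: "inorder B = [Suc 0..<Suc T]"
    using assms(9) by (simp add: rank_labeled_def)
  have set_B: "set_tree B = {1..T}"
    using arg_cong[OF B, of set] by auto
  have sorted: "sorted_wrt (<) (0 # inorder B @ [Suc T])"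
    by (auto simp: B sorted_wrt_append simp del: upt_Suc)
  have a_eq: "a v = tree_value ?C A 0 (Suc T) B"
    if "\<And>t. t \<in> {1..T} \<Longrightarrow> v $ e t = of_bool (t \<in> A)" for v A
  proof -
    have "left_size B t < t" if "t \<in> {1..T}" for t
      using left_size_less[OF B] that set_B by simp
    then have "a v = (\<Sum>t\<in>set_tree B.
      (?C (t - left_size B t - 1) t + ?C t (t + right_size B t + 1)
       - ?C (t - left_size B t - 1) (t + right_size B t + 1)) * v $ e t)"
      unfolding a_def set_B by (intro sum.cong) (auto simp: \<delta>_eq_startup_cost)
    also have "\<dots> = tree_value ?C A 0 (Suc T) B"
      using B set_B that by (intro tree_value_eq_sum_sizes) auto
    finally show ?thesis .
  qed
  \<comment> \<open>The subtracted \<open>?C 0 (Suc T)\<close> is 0; it matches the form of the tree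
    bound.\<close>
  have DCU_eq: "DCU_sum T L PDT CU (\<lambda>t. v $ e t) =
      chain_cost ?C 0 (filter (\<lambda>t. t \<in> A) (inorder B)) (Suc T) - ?C 0 (Suc T)"
    if "\<And>t. t \<in> {1..T} \<Longrightarrow> v $ e t = of_bool (t \<in> A)" for v A
    using DCU_sum_eq_chain_cost[of T "\<lambda>t. v $ e t" A L PDT CU] that
    unfolding B by (simp add: startup_cost_def[of _ _ _ _ 0 "Suc T"])
  have "a v \<le> DCU_sum T L PDT CU (\<lambda>t. v $ e t)" if "v \<in> binary_cube" for v
  proof -
    define A where "A = {t. v $ e t = 1}"
    have A: "v $ e t = of_bool (t \<in> A)" for t
      using that by (auto simp: A_def binary_cube_def)
    have "tree_value ?C A 0 (Suc T) B
        \<le> chain_cost ?C 0 (filter (\<lambda>t. t \<in> A) (inorder B)) (Suc T) - ?C 0 (Suc T)"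
      by (rule tree_value_le_chain_cost[OF startup_cost_monge[OF assms(3,4,6,7)] sorted order.refl])
    then show ?thesis
      using a_eq[OF A] DCU_eq[OF A] by simp
  qed
  then have valid_DCU: "epi_DCU T e L PDT CU \<subseteq> {(v, c). a v \<le> c}"
    by (fastforce simp: epi_DCU_def mem_epigraph)
  have linear: "linear a"
    unfolding a_def
    by (intro linearI) (simp_all add: algebra_simps sum.distrib sum_distrib_left)
  \<comment> \<open>Validity passes from the binary points to their convex hull because the
    half-space is convex.\<close>
  have "convex {(v, c). a v \<le> c}"
  proof -
    have "convex_on UNIV a"
      by (simp add: convex_on_def linear_add[OF linear] linear_scale[OF linear])
    moreover have "{(v, c). a v \<le> c} = epigraph UNIV a"
      by (auto simp: epigraph_def)
    ultimately show ?thesis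
      by (simp only: convex_epigraph)
  qed
  with valid_DCU have valid: "?P \<subseteq> {(v, c). a v \<le> c}"
    unfolding epi_LCU_eq by (rule hull_minimal)
  \<comment> \<open>With unit vectors, \<open>sum f A\<close> is the incidence vector of
    \<open>A\<close>.\<close>
  define f where "f t = axis (e t) (1 :: real)" for t
  have coord: "sum f A $ e t = of_bool (t \<in> A)" if "t \<in> {1..T}" "A \<subseteq> {1..T}" for A t
  proof -
    have "sum f A $ e t = (\<Sum>s\<in>A. if s = t then 1 else 0)"
      unfolding sum_component
    proof (rule sum.cong[OF refl])
      fix s assume "s \<in> A"
      then have "e s = e t \<longleftrightarrow> s = t"
        using inj_on_eq_iff[OF bij_betw_imp_inj_on[OF assms(2)]] that by blast
      then show "f s $ e t = (if s = t then 1 else 0)"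
        by (auto simp: f_def axis_def)
    qed
    then show ?thesis
      using finite_subset[OF that(2)] by (simp add: of_bool_def)
  qed
  have onto: "\<exists>t\<in>{1..T}. i = e t" for i
    using assms(2) by (auto simp: bij_betw_def)
  have tight: "(sum f A, a (sum f A)) \<in> ?P" if "A \<in> tight_sets ?C 0 (Suc T) B" for A
  proof -
    have sub: "A \<subseteq> {1..T}"
      using tight_sets_subset[OF that] by (simp add: set_B)
    have "sum f A \<in> binary_cube"
    proof -
      have "sum f A $ i \<in> {0, 1}" for i
        using onto[of i] coord[OF _ sub] by auto
      then show ?thesis by (simp add: binary_cube_def)
    qed
    moreover have "DCU_sum T L PDT CU (\<lambda>t. sum f A $ e t) = a (sum f A)"
      using a_eq[OF coord[OF _ sub]] DCU_eq[OF coord[OF _ sub]] that by (simp add: tight_sets_def)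
    ultimately show ?thesis
      unfolding epi_LCU_eq by (intro hull_inc) (simp add: epi_DCU_def mem_epigraph)
  qed
  have "induces_facet a ?P"
  proof (rule induces_facetI)
    show "linear a" by (rule linear)
    show "convex ?P" by (simp add: epi_LCU_eq)
    show "a v \<le> c" if "(v, c) \<in> ?P" for v c
      using valid that by auto
    show "(0, 0) \<in> ?P"
      using tight[OF empty_in_tight_sets] linear by (simp add: linear_0)
    \<comment> \<open>A point strictly above the hyperplane shows that the face is proper.\<close>
    show "(0, 1) \<in> ?P"
    proof -
      have "DCU_sum T L PDT CU (\<lambda>t. (0 :: real ^ 'n) $ e t) = 0"
        by (simp add: DCU_sum_def DCU_def)
      then show ?thesis
        unfolding epi_LCU_eq
        by (intro hull_inc) (simp add: epi_DCU_def mem_epigraph binary_cube_def)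
    qed
    show "1 \<noteq> a 0"
      using linear by (simp add: linear_0)
    show "x \<in> span {v. (v, a v) \<in> ?P}" for x
    proof -
      have "sum f ` tight_sets ?C 0 (Suc T) B \<subseteq> {v. (v, a v) \<in> ?P}"
        using tight by auto
      moreover have "f t \<in> span (sum f ` tight_sets ?C 0 (Suc T) B)" if "t \<in> {1..T}" for t
        using sorted that by (intro span_tight_sets) (auto simp: set_B sorted_wrt_append)
      ultimately have "axis i 1 \<in> span {v. (v, a v) \<in> ?P}" for i
        using onto[of i] span_mono unfolding f_def by blast
      then have "(\<Sum>i\<in>UNIV. (x $ i) *\<^sub>R axis i 1) \<in> span {v. (v, a v) \<in> ?P}"
        by (intro span_sum span_scale)
      then show ?thesis
        using basis_expansion[of x] by (simp add: scalar_mult_eq_scaleR)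
    qed
  qed
  then show ?thesis
    unfolding a_def .
qed

end
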